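(* Let $m,n$ be positive integers and let $\mathcal{A}^I=[\underline{\mathcal{A}},\overline{\mathcal{A}}]$ be an interval tensor in $T_{m,n}$ such that $\underline{\mathcal{A}}$ and $\overline{\mathcal{A}}$ are circulant. Then the following are equivalent: (a) $\mathcal{A}^I$ is an interval double B-tensor. (b) $\mathcal{A}^I$ is an interval B-tensor. (c) Both of the following hold: (c$_1$) $\underline{a}_{11\cdots1}>-\sum_{(i_2,\dots,i_m)\neq(1,\dots,1)}\underline{a}_{1i_2\cdots i_m}$; (c$_2$) for all $(j_2,\dots,j_m)\neq(1,\dots,1)$, $$\underline{a}_{11\cdots1}-\overline{a}_{1j_2\cdots j_m}>\sum_{\substack{(i_2,\dots,i_m)\neq(1,\dots,1)\\(i_2,\dots,i_m)\neq(j_2,\dots,j_m)}}(\overline{a}_{1j_2\cdots j_m}-\underline{a}_{1i_2\cdots i_m}).$$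
   Context: $[n]=\{1,\dots,n\}$. $T_{m,n}$ is the set of real tensors $\mathcal{A}=(a_{i_1i_2\cdots i_m})$ with all indices in $[n]$. All index tuples $(i_2,\dots,i_m)$, $(j_2,\dots,j_m)$ range over $[n]^{m-1}$. For $\underline{\mathcal{A}}=(\underline{a}_{i_1\cdots i_m})\le\overline{\mathcal{A}}=(\overline{a}_{i_1\cdots i_m})$ in $T_{m,n}$ (entrywise), the interval tensor is $\mathcal{A}^I=[\underline{\mathcal{A}},\overline{\mathcal{A}}]=\{\mathcal{A}\in T_{m,n}:\underline{\mathcal{A}}\le\mathcal{A}\le\overline{\mathcal{A}}\}$. Circulant tensor: $\mathcal{A}\in T_{m,n}$ is circulant if $a_{j_1j_2\cdots j_m}=a_{k_1k_2\cdots k_m}$ whenever $j_l,k_l\in[n]$ and $k_l\equiv j_l+1\pmod n$ for all $l\in[m]$. B-tensor: $\mathcal{A}\in T_{m,n}$ is a B-tensor if for all $i_1\in[n]$: $\sum_{i_2,\dots,i_m=1}^n a_{i_1i_2\cdots i_m}>0$, and $\frac{1}{n^{m-1}}\sum_{i_2,\dots,i_m=1}^n a_{i_1i_2\cdots i_m}>a_{i_1j_2\cdots j_m}$ for all $(j_2,\dots,j_m)\neq(i_1,\dots,i_1)$. For $\mathcal{A}\in T_{m,n}$ and $i_1\in[n]$, $\gamma_{i_1}^+(\mathcal{A}):=\max\{0,a_{i_1i_2\cdots i_m}:(i_2,\dots,i_m)\neq(i_1,\dots,i_1)\}$. Double B-tensor: $\mathcal{A}\in T_{m,n}$ is a double B-tensor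 if for all $i_1\in[n]$: (i) $a_{i_1i_1\cdots i_1}>\gamma_{i_1}^+(\mathcal{A})$; (ii) $a_{i_1i_1\cdots i_1}-\gamma_{i_1}^+(\mathcal{A})\ge\sum_{(i_2,\dots,i_m)\neq(i_1,\dots,i_1)}(\gamma_{i_1}^+(\mathcal{A})-a_{i_1i_2\cdots i_m})$; (iii) for all $j_1\neq i_1$, $$(a_{i_1\cdots i_1}-\gamma_{i_1}^+(\mathcal{A}))(a_{j_1\cdots j_1}-\gamma_{j_1}^+(\mathcal{A}))>\Big(\sum_{(i_2,\dots,i_m)\neq(i_1,\dots,i_1)}(\gamma_{i_1}^+(\mathcal{A})-a_{i_1i_2\cdots i_m})\Big)\Big(\sum_{(j_2,\dots,j_m)\neq(j_1,\dots,j_1)}(\gamma_{j_1}^+(\mathcal{A})-a_{j_1j_2\cdots j_m})\Big).$$ $\mathcal{A}^I$ is an interval B-tensor (resp. interval double B-tensor) if every $\mathcal{A}\in\mathcal{A}^I$ is a B-tensor (resp. double B-tensor). *)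

theory Defs
  imports Complex_Main "HOL-Library.FuncSet" "HOL-Number_Theory.Cong"
begin

definition tuples :: "nat \<Rightarrow> nat \<Rightarrow> nat list set" where
  "tuples n k = {is. set is \<subseteq> {1..n} \<and> length is = k}"

text \<open>A tensor is a function on index tuples, indices running through \<open>{1..n}\<close>; the entry with
  indices \<open>i\<^sub>1, i\<^sub>2, \<dots>, i\<^sub>m\<close> is \<open>A (i\<^sub>1 # [i\<^sub>2, \<dots>, i\<^sub>m])\<close>. Functions are extensional, so that
  elements of \<open>tensors m n\<close> correspond exactly to families of \<open>n ^ m\<close> real numbers.\<close>

definition tensors :: "nat \<Rightarrow> nat \<Rightarrow> (nat list \<Rightarrow> real) set" where
  "tensors m n = tuples n m \<rightarrow>\<^sub>E UNIV"

definition interval_tensor ::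
  "nat \<Rightarrow> nat \<Rightarrow> (nat list \<Rightarrow> real) \<Rightarrow> (nat list \<Rightarrow> real) \<Rightarrow> (nat list \<Rightarrow> real) set" where
  "interval_tensor m n L U =
     {A \<in> tensors m n. \<forall>is\<in>tuples n m. L is \<le> A is \<and> A is \<le> U is}"

definition circulant :: "nat \<Rightarrow> nat \<Rightarrow> (nat list \<Rightarrow> real) \<Rightarrow> bool" where
  "circulant m n A \<longleftrightarrow> A \<in> tensors m n \<and>
     (\<forall>js\<in>tuples n m. \<forall>ks\<in>tuples n m.
        (\<forall>l<m. [ks ! l = js ! l + 1] (mod n)) \<longrightarrow> A js = A ks)"

text \<open>The tuples \<open>(i\<^sub>2, \<dots>, i\<^sub>m) \<noteq> (i, \<dots>, i)\<close>. For \<open>m = 1\<close> there are none, since the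
  empty tuple is the only one and equals \<open>(i, \<dots>, i)\<close>.\<close>

definition offdiag :: "nat \<Rightarrow> nat \<Rightarrow> nat \<Rightarrow> nat list set" where
  "offdiag m n i = tuples n (m - 1) - {replicate (m - 1) i}"

definition B_tensor :: "nat \<Rightarrow> nat \<Rightarrow> (nat list \<Rightarrow> real) \<Rightarrow> bool" where
  "B_tensor m n A \<longleftrightarrow> A \<in> tensors m n \<and>
     (\<forall>i\<in>{1..n}.
        (\<Sum>is\<in>tuples n (m - 1). A (i # is)) > 0 \<and>
        (\<forall>js\<in>offdiag m n i.
           1 / real n ^ (m - 1) * (\<Sum>is\<in>tuples n (m - 1). A (i # is)) > A (i # js)))"

definition gamma_plus :: "nat \<Rightarrow> nat \<Rightarrow> (nat list \<Rightarrow> real) \<Rightarrow> nat \<Rightarrow> real" where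
  "gamma_plus m n A i = Max (insert 0 ((\<lambda>is. A (i # is)) ` offdiag m n i))"

definition double_B_tensor :: "nat \<Rightarrow> nat \<Rightarrow> (nat list \<Rightarrow> real) \<Rightarrow> bool" where
  "double_B_tensor m n A \<longleftrightarrow> A \<in> tensors m n \<and>
     (\<forall>i\<in>{1..n}.
        A (replicate m i) > gamma_plus m n A i \<and>
        A (replicate m i) - gamma_plus m n A i
          \<ge> (\<Sum>is\<in>offdiag m n i. gamma_plus m n A i - A (i # is)) \<and>
        (\<forall>j\<in>{1..n}. j \<noteq> i \<longrightarrow>
           (A (replicate m i) - gamma_plus m n A i) * (A (replicate m j) - gamma_plus m n A j)
           > (\<Sum>is\<in>offdiag m n i. gamma_plus m n A i - A (i # is)) *
             (\<Sum>js\<in>offdiag m n j. gamma_plus m n A j - A (j # js))))"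

definition interval_B_tensor ::
  "nat \<Rightarrow> nat \<Rightarrow> (nat list \<Rightarrow> real) \<Rightarrow> (nat list \<Rightarrow> real) \<Rightarrow> bool" where
  "interval_B_tensor m n L U \<longleftrightarrow> (\<forall>A\<in>interval_tensor m n L U. B_tensor m n A)"

definition interval_double_B_tensor ::
  "nat \<Rightarrow> nat \<Rightarrow> (nat list \<Rightarrow> real) \<Rightarrow> (nat list \<Rightarrow> real) \<Rightarrow> bool" where
  "interval_double_B_tensor m n L U \<longleftrightarrow> (\<forall>A\<in>interval_tensor m n L U. double_B_tensor m n A)"

end

theory Submission
  imports Defs
begin

text \<open>
  Both tensor classes are governed by the same quantity of a row \<open>i\<close>: with
  \<open>\<gamma> = gamma_plus m n A i\<close>, the diagonal excess \<open>A (replicate m i) - \<gamma>\<close> minus the off-diagonal deficit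
  \<open>\<Sum>is\<in>offdiag m n i. \<gamma> - A (i # is)\<close> equals the row sum minus \<open>n ^ (m - 1) * \<gamma>\<close>, because a
  row has \<open>n ^ (m - 1)\<close> entries (\<open>excess_minus_deficit\<close>). A B-tensor is
  one for which this is positive in every row (\<open>B_tensor_iff\<close>), that is, one whose excesses
  strictly exceed the deficits. As deficits are nonnegative, multiplying two such inequalities shows that every B-tensor is a double B-tensor. Conversely,
  a double B-tensor satisfies these inequalities weakly and their pairwise products strictly; if
  two distinct rows have the same excess and the same deficit, then the product inequality
  compares two squares and rules out equality (\<open>double_B_tensor_matching_rows\<close>).

  The cyclic shift of the indices carries row \<open>i\<close> of a circulant tensor to row \<open>i + 1\<close>. Hence an
  interval double B-tensor with circulant end points can be tested on members with matching rows:
  the lower end point gives (c1), and raising the entry at \<open>(1, js)\<close> together with its shift in row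
  2 from the lower to the upper bound gives (c2). This member is in general not circulant, but only
  the rows 1 and 2 have to match.

  Finally (c1) and (c2) say that the least possible row sum in row 1 is positive, and that each
  off-diagonal entry stays below the mean of its row even if it is as large as possible and all
  other entries are as small as possible. The shift transports this condition to all rows
  (\<open>dominated_row_all\<close>), and it is exactly what makes every member of the interval a B-tensor
  (\<open>dominated_row_interval\<close>).
\<close>

section \<open>Row sums and the maximal off-diagonal entry\<close>

lemma finite_tuples [simp]: "finite (tuples n k)"
  unfolding tuples_def using finite_lists_length_eq[of "{1..n}" k] by simp

lemma card_tuples: "card (tuples n k) = n ^ k"
  unfolding tuples_def using card_lists_length_eq[of "{1..n}" k] by simp

lemma finite_offdiag [simp]: "finite (offdiag m n i)"
  by (simp add: offdiag_def)

lemma replicate_in_tuples: "i \<in> {1..n} \<Longrightarrow> replicate k i \<in> tuples n k"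
  by (auto simp: tuples_def)

lemma Cons_in_tuples:
  "\<lbrakk>m \<ge> 1; i \<in> {1..n}; is \<in> tuples n (m - 1)\<rbrakk> \<Longrightarrow> i # is \<in> tuples n m"
  by (auto simp: tuples_def)

lemma replicate_eq_Cons: "m \<ge> 1 \<Longrightarrow> replicate m i = i # replicate (m - 1) i"
  by (cases m) auto

lemma gamma_plus_nonneg: "gamma_plus m n A i \<ge> 0"
  unfolding gamma_plus_def by (rule Max_ge) auto

lemma gamma_plus_ge: "is \<in> offdiag m n i \<Longrightarrow> A (i # is) \<le> gamma_plus m n A i"
  unfolding gamma_plus_def by (rule Max_ge) auto

lemma deficit_nonneg: "(\<Sum>is\<in>offdiag m n i. gamma_plus m n A i - A (i # is)) \<ge> 0"
  by (rule sum_nonneg) (simp add: gamma_plus_ge)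

lemma sum_row_split:
  assumes "m \<ge> 1" "i \<in> {1..n}"
  shows "(\<Sum>is\<in>tuples n (m - 1). A (i # is)) = A (replicate m i) + (\<Sum>is\<in>offdiag m n i. A (i # is))"
  unfolding offdiag_def replicate_eq_Cons[OF assms(1)]
  by (rule sum.remove) (use assms in \<open>simp_all add: replicate_in_tuples\<close>)

lemma card_offdiag:
  assumes "i \<in> {1..n}"
  shows "real (card (offdiag m n i)) = real n ^ (m - 1) - 1"
proof -
  have "card (tuples n (m - 1)) = Suc (card (offdiag m n i))"
    unfolding offdiag_def by (rule card.remove) (use assms in \<open>simp_all add: replicate_in_tuples\<close>)
  then have "real (n ^ (m - 1)) = real (Suc (card (offdiag m n i)))"
    unfolding card_tuples by simp
  then show ?thesis by simp
qed

lemma excess_minus_deficit: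
  assumes "m \<ge> 1" "i \<in> {1..n}"
  shows "(A (replicate m i) - c) - (\<Sum>is\<in>offdiag m n i. c - A (i # is))
    = (\<Sum>is\<in>tuples n (m - 1). A (i # is)) - real n ^ (m - 1) * c"
  unfolding sum_row_split[OF assms]
  by (simp add: sum_subtractf card_offdiag[OF assms(2)] algebra_simps)

section \<open>B-tensors and double B-tensors\<close>

text \<open>The two requirements on a row compare its mean with 0 and with each off-diagonal entry, that is,
  with the members of the set whose maximum is \<open>gamma_plus\<close>.\<close>

lemma B_tensor_iff:
  assumes "n \<ge> 1"
  shows "B_tensor m n A \<longleftrightarrow> A \<in> tensors m n \<and>
    (\<forall>i\<in>{1..n}. real n ^ (m - 1) * gamma_plus m n A i < (\<Sum>is\<in>tuples n (m - 1). A (i # is)))"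
proof -
  define N where "N = real n ^ (m - 1)"
  have N: "N > 0" using assms by (simp add: N_def)
  have "(0 < s \<and> (\<forall>js\<in>offdiag m n i. A (i # js) < 1 / N * s)) \<longleftrightarrow> N * gamma_plus m n A i < s" for s i
  proof -
    have "N * gamma_plus m n A i < s \<longleftrightarrow> gamma_plus m n A i < 1 / N * s"
      using N by (simp add: field_simps)
    also have "\<dots> \<longleftrightarrow> 0 < 1 / N * s \<and> (\<forall>js\<in>offdiag m n i. A (i # js) < 1 / N * s)"
      unfolding gamma_plus_def by (subst Max_less_iff) auto
    finally show ?thesis using N by (simp add: zero_less_divide_iff)
  qed
  then show ?thesis unfolding B_tensor_def N_def by simp
qed

lemma B_tensor_imp_double_B_tensor:
  assumes "m \<ge> 1" "n \<ge> 1" "B_tensor m n A"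
  shows "double_B_tensor m n A"
proof -
  define g where "g = gamma_plus m n A"
  define E where "E = (\<lambda>i. A (replicate m i) - g i)"
  define S where "S = (\<lambda>i. \<Sum>is\<in>offdiag m n i. g i - A (i # is))"
  have S: "S i \<ge> 0" for i unfolding S_def g_def by (rule deficit_nonneg)
  have ES: "E i > S i" if "i \<in> {1..n}" for i
    using assms(3) that excess_minus_deficit[OF assms(1) that, of A "g i"]
    unfolding B_tensor_iff[OF assms(2)] E_def S_def g_def by fastforce
  have "E i * E j > S i * S j" if "i \<in> {1..n}" "j \<in> {1..n}" for i j
    using ES[OF that(1)] ES[OF that(2)] S[of i] S[of j] by (intro mult_strict_mono) auto
  moreover have "E i > 0" if "i \<in> {1..n}" for i using ES[OF that] S[of i] by simp
  ultimately have "\<forall>i\<in>{1..n}. A (replicate m i) > g i \<and> E i \<ge> S i \<and>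
      (\<forall>j\<in>{1..n}. j \<noteq> i \<longrightarrow> E i * E j > S i * S j)"
    using ES by (auto simp: less_imp_le) (simp add: E_def)
  then show ?thesis
    using assms(3) unfolding double_B_tensor_def B_tensor_def E_def S_def g_def by blast
qed

section \<open>The cyclic shift of the indices\<close>

definition cyc :: "nat \<Rightarrow> nat \<Rightarrow> nat" where
  "cyc n x = x mod n + 1"

lemma cyc_less: "x < n \<Longrightarrow> cyc n x = Suc x"
  by (simp add: cyc_def)

lemma bij_betw_cyc: "bij_betw (cyc n) {1..n} {1..n}"
proof -
  have "inj_on (cyc n) {1..n}"
  proof (rule inj_onI)
    fix x y assume "x \<in> {1..n}" "y \<in> {1..n}" "cyc n x = cyc n y"
    then show "x = y" by (cases "x = n"; cases "y = n") (auto simp: cyc_def)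
  qed
  moreover have "cyc n ` {1..n} \<subseteq> {1..n}" by (auto simp: cyc_def Suc_le_eq)
  ultimately show ?thesis by (simp add: bij_betw_def endo_inj_surj)
qed

lemma cyc_in: "i \<in> {1..n} \<Longrightarrow> cyc n i \<in> {1..n}"
  using bij_betw_cyc by (rule bij_betw_apply)

lemma bij_betw_map_cyc: "bij_betw (map (cyc n)) (tuples n k) (tuples n k)"
proof -
  have inj: "inj_on (cyc n) {1..n}" and im: "cyc n ` {1..n} = {1..n}"
    using bij_betw_cyc[of n] by (auto simp: bij_betw_def)
  have "inj_on (map (cyc n)) (tuples n k)"
  proof (rule inj_onI)
    fix xs ys assume *: "xs \<in> tuples n k" "ys \<in> tuples n k" "map (cyc n) xs = map (cyc n) ys"
    have "inj_on (cyc n) (set xs \<union> set ys)"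
      by (rule inj_on_subset[OF inj]) (use * in \<open>auto simp: tuples_def\<close>)
    with *(3) show "xs = ys" by (simp add: inj_on_map_eq_map)
  qed
  moreover have "map (cyc n) ` tuples n k \<subseteq> tuples n k"
    using im by (fastforce simp: tuples_def)
  ultimately show ?thesis by (simp add: bij_betw_def endo_inj_surj)
qed

lemma map_cyc_in_tuples: "is \<in> tuples n k \<Longrightarrow> map (cyc n) is \<in> tuples n k"
  using bij_betw_map_cyc by (rule bij_betw_apply)

lemma map_cyc_eq_iff:
  "\<lbrakk>is \<in> tuples n k; js \<in> tuples n k\<rbrakk> \<Longrightarrow> map (cyc n) is = map (cyc n) js \<longleftrightarrow> is = js"
  using bij_betw_map_cyc[of n k] by (auto simp: bij_betw_def dest: inj_onD)

lemma bij_betw_map_cyc_offdiag: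
  assumes "i \<in> {1..n}"
  shows "bij_betw (map (cyc n)) (offdiag m n i) (offdiag m n (cyc n i))"
proof -
  have "bij_betw (map (cyc n)) {replicate (m - 1) i} {replicate (m - 1) (cyc n i)}"
    by (simp add: bij_betw_def)
  moreover have "{replicate (m - 1) i} \<subseteq> tuples n (m - 1)"
      "{replicate (m - 1) (cyc n i)} \<subseteq> tuples n (m - 1)"
    using replicate_in_tuples[OF assms] replicate_in_tuples[OF cyc_in[OF assms]] by simp_all
  ultimately show ?thesis
    unfolding offdiag_def by (intro bij_betw_DiffI[OF bij_betw_map_cyc])
qed

lemma circulant_map_cyc:
  assumes "circulant m n A" "is \<in> tuples n m"
  shows "A (map (cyc n) is) = A is"
proof -
  have "\<forall>l<m. [map (cyc n) is ! l = is ! l + 1] (mod n)"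
    using assms(2) by (auto simp: tuples_def cyc_def cong_def mod_simps)
  then show ?thesis
    using assms map_cyc_in_tuples[OF assms(2)] unfolding circulant_def by metis
qed

lemma circulant_row:
  assumes "circulant m n A" "m \<ge> 1" "i \<in> {1..n}" "is \<in> tuples n (m - 1)"
  shows "A (cyc n i # map (cyc n) is) = A (i # is)"
  using circulant_map_cyc[OF assms(1) Cons_in_tuples[OF assms(2-4)]] by simp

lemma sum_row_shift:
  assumes "\<And>is. is \<in> tuples n k \<Longrightarrow> A (cyc n i # map (cyc n) is) = A (i # is)"
  shows "(\<Sum>is\<in>tuples n k. A (cyc n i # is)) = (\<Sum>is\<in>tuples n k. A (i # is))"
  by (rule sum.reindex_bij_betw[OF bij_betw_map_cyc, symmetric, THEN trans])
     (use assms in \<open>auto intro: sum.cong\<close>)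

section \<open>Double B-tensors with two matching rows\<close>

text \<open>Since the excesses agree and the deficits agree, equality of excess and deficit in row \<open>i\<close>
  would turn the strict product inequality for the pair of rows into \<open>x * x > x * x\<close>. If
  \<open>n = 1\<close> there is no second row, but the deficit is an empty sum and the positivity of the
  excess suffices.\<close>

lemma double_B_tensor_matching_rows:
  assumes B: "double_B_tensor m n A" and m: "m \<ge> 1" and i: "i \<in> {1..n}"
    and row: "\<And>is. is \<in> tuples n (m - 1) \<Longrightarrow> A (cyc n i # map (cyc n) is) = A (i # is)"
  shows "real n ^ (m - 1) * gamma_plus m n A i < (\<Sum>is\<in>tuples n (m - 1). A (i # is))"
proof -
  define g where "g = gamma_plus m n A"
  define E where "E = (\<lambda>i. A (replicate m i) - g i)"
  define S where "S = (\<lambda>i. \<Sum>is\<in>offdiag m n i. g i - A (i # is))"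
  let ?j = "cyc n i"
  have j: "?j \<in> {1..n}" using i by (rule cyc_in)
  have main: "\<forall>i\<in>{1..n}. E i > 0 \<and> E i \<ge> S i \<and> (\<forall>j\<in>{1..n}. j \<noteq> i \<longrightarrow> E i * E j > S i * S j)"
    using B unfolding double_B_tensor_def E_def S_def g_def by simp
  have "E i > S i"
  proof (cases "n = 1")
    case True
    have "replicate (m - 1) (1::nat) = is" if "is \<in> tuples 1 (m - 1)" for "is"
      using that by (intro replicate_eqI[symmetric]) (auto simp: tuples_def)
    then have "offdiag m n i = {}" using True i by (auto simp: offdiag_def)
    then have "S i = 0" by (simp add: S_def)
    moreover have "E i > 0" using main i by blast
    ultimately show ?thesis by simp
  next
    case False
    then have ji: "?j \<noteq> i" using i by (cases "i = n") (auto simp: cyc_def)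
    have off: "offdiag m n ?j = map (cyc n) ` offdiag m n i"
      using bij_betw_map_cyc_offdiag[OF i] by (simp add: bij_betw_def)
    have row_off: "A (?j # map (cyc n) is) = A (i # is)" if "is \<in> offdiag m n i" for "is"
      using that row by (simp add: offdiag_def)
    have "(\<lambda>is. A (?j # is)) ` offdiag m n ?j = (\<lambda>is. A (i # is)) ` offdiag m n i"
      unfolding off image_image by (rule image_cong) (simp_all add: row_off)
    then have g: "g ?j = g i" by (simp add: g_def gamma_plus_def)
    have "A (replicate m ?j) = A (replicate m i)"
      using row[OF replicate_in_tuples[OF i]] m by (simp add: replicate_eq_Cons)
    then have E: "E ?j = E i" by (simp add: E_def g)
    have "S ?j = (\<Sum>is\<in>offdiag m n i. g ?j - A (?j # map (cyc n) is))"
      unfolding S_def by (rule sum.reindex_bij_betw[OF bij_betw_map_cyc_offdiag[OF i], symmetric])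
    also have "\<dots> = S i" unfolding S_def g by (rule sum.cong) (simp_all add: row_off)
    finally have S: "S ?j = S i" .
    have "E i * E i > S i * S i" using main i j ji E S by metis
    then have "E i \<noteq> S i" by auto
    moreover have "E i \<ge> S i" using main i by blast
    ultimately show ?thesis by simp
  qed
  then show ?thesis
    using excess_minus_deficit[OF m i, of A "g i"] unfolding E_def S_def g_def by simp
qed

section \<open>The row condition on the bounds of an interval\<close>

text \<open>The worst case for an off-diagonal entry \<open>js\<close> of row \<open>i\<close>: the entry itself is at its upper
  bound, while all others, the diagonal included, are at their lower bounds. In this form the
  diagonal entry is not singled out on the right-hand side, which makes the condition visibly
  invariant under the shift.\<close>

definition dominated_row ::
  "nat \<Rightarrow> nat \<Rightarrow> (nat list \<Rightarrow> real) \<Rightarrow> (nat list \<Rightarrow> real) \<Rightarrow> nat \<Rightarrow> bool" where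
  "dominated_row m n L U i \<longleftrightarrow>
     0 < (\<Sum>is\<in>tuples n (m - 1). L (i # is)) \<and>
     (\<forall>js\<in>offdiag m n i.
        real n ^ (m - 1) * U (i # js)
          < U (i # js) + (\<Sum>is\<in>tuples n (m - 1) - {js}. L (i # is)))"

lemma dominated_row_iff:
  assumes m: "m \<ge> 1" and i: "i \<in> {1..n}"
  shows "dominated_row m n L U i \<longleftrightarrow>
    L (replicate m i) > - (\<Sum>is\<in>offdiag m n i. L (i # is)) \<and>
    (\<forall>js\<in>offdiag m n i.
       L (replicate m i) - U (i # js) > (\<Sum>is\<in>offdiag m n i - {js}. U (i # js) - L (i # is)))"
proof -
  have "real n ^ (m - 1) * U (i # js) < U (i # js) + (\<Sum>is\<in>tuples n (m - 1) - {js}. L (i # is))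
    \<longleftrightarrow> L (replicate m i) - U (i # js) > (\<Sum>is\<in>offdiag m n i - {js}. U (i # js) - L (i # is))"
    if js: "js \<in> offdiag m n i" for js
  proof -
    have "js \<in> tuples n (m - 1)" using js by (simp add: offdiag_def)
    then have "(\<Sum>is\<in>tuples n (m - 1). L (i # is))
        = L (i # js) + (\<Sum>is\<in>tuples n (m - 1) - {js}. L (i # is))"
      by (intro sum.remove) simp_all
    moreover have "(\<Sum>is\<in>offdiag m n i. U (i # js) - L (i # is))
        = (U (i # js) - L (i # js)) + (\<Sum>is\<in>offdiag m n i - {js}. U (i # js) - L (i # is))"
      by (intro sum.remove js) simp_all
    ultimately show ?thesis
      using excess_minus_deficit[OF m i, of L "U (i # js)"] by linarith
  qed
  then show ?thesis
    unfolding dominated_row_def sum_row_split[OF m i] by auto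
qed

lemma dominated_row_shift:
  assumes L: "circulant m n L" and U: "circulant m n U" and m: "m \<ge> 1" and i: "i \<in> {1..n}"
    and dom: "dominated_row m n L U i"
  shows "dominated_row m n L U (cyc n i)"
proof -
  let ?T = "tuples n (m - 1)" and ?j = "cyc n i"
  note rowL = circulant_row[OF L m i] and rowU = circulant_row[OF U m i]
  have "0 < (\<Sum>is\<in>?T. L (?j # is))"
    using dom sum_row_shift[of n "m - 1" L i, OF rowL] by (simp add: dominated_row_def)
  moreover have "real n ^ (m - 1) * U (?j # ks) < U (?j # ks) + (\<Sum>is\<in>?T - {ks}. L (?j # is))"
    if "ks \<in> offdiag m n ?j" for ks
  proof -
    have "ks \<in> map (cyc n) ` offdiag m n i"
      using that bij_betw_imp_surj_on[OF bij_betw_map_cyc_offdiag[OF i]] by simp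
    then obtain js where js: "js \<in> offdiag m n i" and ks: "ks = map (cyc n) js" by blast
    have T: "js \<in> ?T" using js by (simp add: offdiag_def)
    have bij: "bij_betw (map (cyc n)) (?T - {js}) (?T - {ks})"
      by (rule bij_betw_DiffI[OF bij_betw_map_cyc]) (use T ks in \<open>auto simp: bij_betw_def map_cyc_in_tuples\<close>)
    have "(\<Sum>is\<in>?T - {ks}. L (?j # is)) = (\<Sum>is\<in>?T - {js}. L (?j # map (cyc n) is))"
      by (rule sum.reindex_bij_betw[OF bij, symmetric])
    also have "\<dots> = (\<Sum>is\<in>?T - {js}. L (i # is))"
      by (rule sum.cong) (simp_all add: rowL)
    finally show ?thesis
      using dom js rowU[OF T] ks by (simp add: dominated_row_def)
  qed
  ultimately show ?thesis by (simp add: dominated_row_def)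
qed

lemma dominated_row_all:
  assumes "circulant m n L" "circulant m n U" "m \<ge> 1" "dominated_row m n L U 1" "i \<in> {1..n}"
  shows "dominated_row m n L U i"
proof -
  have "1 \<le> i" using assms(5) by simp
  then show ?thesis using assms(5)
  proof (induction i rule: dec_induct)
    case base
    show ?case by (rule assms(4))
  next
    case (step k)
    then have "dominated_row m n L U (cyc n k)"
      by (intro dominated_row_shift[OF assms(1-3)]) auto
    then show ?case using step by (simp add: cyc_less)
  qed
qed

text \<open>In the inequality for \<open>js\<close>, replacing \<open>U (i # js)\<close> by the smaller \<open>A (i # js)\<close> lowers the left
  side by \<open>n ^ (m - 1)\<close> times the difference and the right side only once, while replacing
  \<open>L\<close> by \<open>A\<close> raises the right side.\<close>

lemma dominated_row_interval:
  assumes m: "m \<ge> 1" and n: "n \<ge> 1" and A: "A \<in> interval_tensor m n L U"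
    and dom: "\<And>i. i \<in> {1..n} \<Longrightarrow> dominated_row m n L U i"
  shows "B_tensor m n A"
proof -
  let ?T = "tuples n (m - 1)"
  define N where "N = real n ^ (m - 1)"
  have N: "N \<ge> 1" using n by (simp add: N_def)
  have "(\<Sum>is\<in>?T. A (i # is)) > 0 \<and>
      (\<forall>js\<in>offdiag m n i. 1 / N * (\<Sum>is\<in>?T. A (i # is)) > A (i # js))"
    if i: "i \<in> {1..n}" for i
  proof (intro conjI ballI)
    have bounds: "L (i # is) \<le> A (i # is) \<and> A (i # is) \<le> U (i # is)" if "is \<in> ?T" for "is"
      using A Cons_in_tuples[OF m i that] by (simp add: interval_tensor_def)
    have "(\<Sum>is\<in>?T. L (i # is)) \<le> (\<Sum>is\<in>?T. A (i # is))"
      by (rule sum_mono) (simp add: bounds)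
    then show "(\<Sum>is\<in>?T. A (i # is)) > 0"
      using dom[OF i] by (simp add: dominated_row_def)
    fix js assume js: "js \<in> offdiag m n i"
    then have T: "js \<in> ?T" by (simp add: offdiag_def)
    have "N * U (i # js) < U (i # js) + (\<Sum>is\<in>?T - {js}. L (i # is))"
      using dom[OF i] js by (simp add: dominated_row_def N_def)
    moreover have "(N - 1) * A (i # js) \<le> (N - 1) * U (i # js)"
      using N bounds[OF T] by (intro mult_left_mono) auto
    moreover have "(\<Sum>is\<in>?T - {js}. L (i # is)) \<le> (\<Sum>is\<in>?T - {js}. A (i # is))"
      by (rule sum_mono) (simp add: bounds)
    moreover have "(\<Sum>is\<in>?T. A (i # is)) = A (i # js) + (\<Sum>is\<in>?T - {js}. A (i # is))"
      using T by (intro sum.remove) simp_all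
    ultimately have "N * A (i # js) < (\<Sum>is\<in>?T. A (i # is))"
      by (simp add: algebra_simps)
    then show "1 / N * (\<Sum>is\<in>?T. A (i # is)) > A (i # js)"
      using N by (simp add: field_simps)
  qed
  then show ?thesis
    using A unfolding B_tensor_def interval_tensor_def N_def by auto
qed

text \<open>The row condition is necessary already for double B-tensors: the members used as tests are
  \<open>L\<close> itself and \<open>L\<close> with the entry \<open>(1, js)\<close> and its shift raised to their upper bounds.\<close>

lemma interval_double_B_tensor_imp_dominated_row:
  assumes m: "m \<ge> 1" and n: "n \<ge> 1" and "L \<in> tensors m n" "U \<in> tensors m n"
    and LU: "\<forall>is\<in>tuples n m. L is \<le> U is"
    and L: "circulant m n L" and U: "circulant m n U"
    and dbl: "interval_double_B_tensor m n L U"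
  shows "dominated_row m n L U 1"
proof -
  let ?T = "tuples n (m - 1)" and ?j = "cyc n 1"
  have 1: "1 \<in> {1..n}" using n by simp
  note rowL = circulant_row[OF L m 1] and rowU = circulant_row[OF U m 1]
  have "L \<in> interval_tensor m n L U" using assms by (simp add: interval_tensor_def)
  then have "double_B_tensor m n L" using dbl by (simp add: interval_double_B_tensor_def)
  from double_B_tensor_matching_rows[OF this m 1 rowL]
  have "real n ^ (m - 1) * gamma_plus m n L 1 < (\<Sum>is\<in>?T. L (1 # is))" .
  moreover have "0 \<le> real n ^ (m - 1) * gamma_plus m n L 1" by (simp add: gamma_plus_nonneg)
  ultimately have "0 < (\<Sum>is\<in>?T. L (1 # is))" by linarith
  moreover have "real n ^ (m - 1) * U (1 # js) < U (1 # js) + (\<Sum>is\<in>?T - {js}. L (1 # is))"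
    if js: "js \<in> offdiag m n 1" for js
  proof -
    have T: "js \<in> ?T" using js by (simp add: offdiag_def)
    have j1: "?j \<noteq> 1"
    proof
      \<comment> \<open>An off-diagonal index tuple exists only if \<open>n > 1\<close>.\<close>
      assume "?j = 1"
      then have "n = 1" using n by (cases "n = 1") (auto simp: cyc_def)
      then have "js = replicate (m - 1) 1"
        using T by (intro replicate_eqI) (auto simp: tuples_def)
      then show False using js by (simp add: offdiag_def)
    qed
    define P where "P = {1 # js, ?j # map (cyc n) js}"
    define A where "A = (\<lambda>is. if is \<in> P then U is else L is)"
    have "A \<in> tensors m n"
      using assms(3,4) by (auto simp: A_def tensors_def PiE_def extensional_def)
    then have "A \<in> interval_tensor m n L U"
      using LU by (auto simp: interval_tensor_def A_def)
    then have dblA: "double_B_tensor m n A" using dbl by (simp add: interval_double_B_tensor_def)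
    have A1: "A (1 # is) = (if is = js then U (1 # is) else L (1 # is))" for "is"
      using j1 by (auto simp: A_def P_def)
    have rowA: "A (?j # map (cyc n) is) = A (1 # is)" if "is \<in> ?T" for "is"
    proof -
      have "?j # map (cyc n) is \<in> P \<longleftrightarrow> is = js"
        using j1 map_cyc_eq_iff[OF that T] by (simp add: P_def)
      then have "A (?j # map (cyc n) is)
          = (if is = js then U (?j # map (cyc n) is) else L (?j # map (cyc n) is))"
        unfolding A_def by (simp only:)
      also have "\<dots> = A (1 # is)" unfolding A1 rowL[OF that] rowU[OF that] ..
      finally show ?thesis .
    qed
    have "real n ^ (m - 1) * U (1 # js) \<le> real n ^ (m - 1) * gamma_plus m n A 1"
      using gamma_plus_ge[OF js, of A] unfolding A1 by (intro mult_left_mono) simp_all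
    also have "\<dots> < (\<Sum>is\<in>?T. A (1 # is))"
      by (rule double_B_tensor_matching_rows[OF dblA m 1 rowA])
    also have "\<dots> = A (1 # js) + (\<Sum>is\<in>?T - {js}. A (1 # is))"
      using T by (intro sum.remove) simp_all
    also have "\<dots> = U (1 # js) + (\<Sum>is\<in>?T - {js}. L (1 # is))"
      unfolding A1 by simp
    finally show ?thesis .
  qed
  ultimately show ?thesis by (simp add: dominated_row_def)
qed

section \<open>The equivalence\<close>

theorem proposition4p8:
  fixes m n :: nat and L U :: "nat list \<Rightarrow> real"
  assumes "m \<ge> 1" and "n \<ge> 1"
    and "L \<in> tensors m n" and "U \<in> tensors m n"
    and "\<forall>is\<in>tuples n m. L is \<le> U is"
    and "circulant m n L" and "circulant m n U"
  shows "(interval_double_B_tensor m n L U \<longleftrightarrow> interval_B_tensor m n L U) \<and>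
    (interval_B_tensor m n L U \<longleftrightarrow>
       L (replicate m 1) > - (\<Sum>is\<in>offdiag m n 1. L (1 # is)) \<and>
       (\<forall>js\<in>offdiag m n 1.
          L (replicate m 1) - U (1 # js)
          > (\<Sum>is\<in>offdiag m n 1 - {js}. U (1 # js) - L (1 # is))))"
proof -
  have "1 \<in> {1..n}" using assms(2) by simp
  note row = dominated_row_iff[OF assms(1) this, of L U]
  have "interval_double_B_tensor m n L U \<Longrightarrow> dominated_row m n L U 1"
    by (rule interval_double_B_tensor_imp_dominated_row[OF assms])
  moreover have "interval_B_tensor m n L U" if "dominated_row m n L U 1"
    unfolding interval_B_tensor_def
    using dominated_row_interval[OF assms(1,2)] dominated_row_all[OF assms(6,7,1) that] by blast
  moreover have "interval_B_tensor m n L U \<Longrightarrow> interval_double_B_tensor m n L U"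
    unfolding interval_B_tensor_def interval_double_B_tensor_def
    using B_tensor_imp_double_B_tensor[OF assms(1,2)] by blast
  ultimately show ?thesis unfolding row[symmetric] by blast
qed

end
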